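(* Let $p$ be a prime number and $w$ a nonempty word over $[\![p]\!]$. Then the sequence $(a_{p;w}(n))_{n\in\mathbf N}$ is $p$-uniformly morphic, and if $|w|>1$ and $w\neq 10$, it is not purely morphic.
   Context: $[\![p]\!]=\{0,\dots,p-1\}$; $10$ denotes the two-letter word $1\,0$. For $n\ge0$, $[n]_p$ is the base-$p$ expansion of $n$ without leading zeros, with $[0]_p=0$; $e_{p;w}(n)$ is the number of occurrences of $w$ as a factor (contiguous block, counted at every starting position) of $[n]_p$, and $a_{p;w}(n)\in[\![p]\!]$ with $a_{p;w}(n)\equiv e_{p;w}(n)\pmod p$. A morphism $\phi:B^*\to B^*$ is non-erasing if $\phi(b)\neq\varepsilon$ for all letters $b$, $k$-uniform if $|\phi(b)|=k$ for all letters $b$. An infinite sequence $a$ over $A$ is morphic if there are an alphabet $B$, an infinite sequence $b$ over $B$ fixed by a non-erasing morphism $\phi:B^*\to B^*$, and a letter-to-letter map $\psi:B\to A$ with $a=\psi(b)$; $k$-uniformly morphic if $\phi$ can be taken $k$-uniform; purely morphic if one can take $B=A$, $\psi=\mathrm{id}$, i.e. $a$ is a fixed point of a non-erasing morphism $A^*\to A^*$ (here $A=[\![p]\!]$).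
   Formalization: "Fixed by a non-erasing morphism" is taken in the standard sense that φ is prolongable on the first letter, φ(b₀)=b₀u with u nonempty; read literally, the identity morphism would make every sequence purely morphic. Alphabets are finite. *)

theory Defs
  imports "HOL-Computational_Algebra.Primes"
begin

(* Most significant digit first.  For base at least 2 there are no leading zeros,
   and 0 is written as the one-letter word 0. *)
function base_expansion :: "nat \<Rightarrow> nat \<Rightarrow> nat list" where
  "base_expansion p n =
     (if p < 2 \<or> n < p then [n] else base_expansion p (n div p) @ [n mod p])"
  by pat_completeness auto
termination
  by (relation "measure snd") auto

declare base_expansion.simps [simp del]

definition occurrences :: "'a list \<Rightarrow> 'a list \<Rightarrow> nat" where
  "occurrences w u = card {i. i + length w \<le> length u \<and> take (length w) (drop i u) = w}"

definition block_count :: "nat \<Rightarrow> nat list \<Rightarrow> nat \<Rightarrow> nat" where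
  "block_count p w n = occurrences w (base_expansion p n)"

definition block_seq :: "nat \<Rightarrow> nat list \<Rightarrow> nat \<Rightarrow> nat" where
  "block_seq p w n = block_count p w n mod p"

(* A morphism of the free monoid over the alphabet B is given by the images of the letters;
   it is extended to words by concatenation. *)
definition morphism_on :: "'b set \<Rightarrow> ('b \<Rightarrow> 'b list) \<Rightarrow> bool" where
  "morphism_on B \<phi> \<longleftrightarrow> (\<forall>x\<in>B. \<phi> x \<in> lists B)"

definition morph_ext :: "('b \<Rightarrow> 'b list) \<Rightarrow> 'b list \<Rightarrow> 'b list" where
  "morph_ext \<phi> u = concat (map \<phi> u)"

definition nonerasing_on :: "'b set \<Rightarrow> ('b \<Rightarrow> 'b list) \<Rightarrow> bool" where
  "nonerasing_on B \<phi> \<longleftrightarrow> (\<forall>x\<in>B. \<phi> x \<noteq> [])"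

definition uniform_on :: "'b set \<Rightarrow> nat \<Rightarrow> ('b \<Rightarrow> 'b list) \<Rightarrow> bool" where
  "uniform_on B k \<phi> \<longleftrightarrow> (\<forall>x\<in>B. length (\<phi> x) = k)"

definition seq_prefix :: "(nat \<Rightarrow> 'b) \<Rightarrow> nat \<Rightarrow> 'b list" where
  "seq_prefix b n = map b [0..<n]"

(* The infinite sequence phi(b) equals b: the image of every prefix of b is a prefix of b.
   For non-erasing phi the lengths of these images are unbounded, so this determines phi(b). *)
definition fixed_by :: "('b \<Rightarrow> 'b list) \<Rightarrow> (nat \<Rightarrow> 'b) \<Rightarrow> bool" where
  "fixed_by \<phi> b \<longleftrightarrow>
     (\<forall>n. morph_ext \<phi> (seq_prefix b n) = seq_prefix b (length (morph_ext \<phi> (seq_prefix b n))))"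

(* Fixed points are understood in the usual sense of the theory of morphic sequences: phi is
   prolongable on the first letter of b, that is phi(b_0) = b_0 u with u nonempty, so that b is
   the limit of the words phi^n(b_0).  Without this the identity morphism would make every
   sequence over B a fixed point.  For k-uniform phi with k at least 2 it holds automatically. *)
definition prolongable_on :: "('b \<Rightarrow> 'b list) \<Rightarrow> 'b \<Rightarrow> bool" where
  "prolongable_on \<phi> x \<longleftrightarrow> (\<exists>u. u \<noteq> [] \<and> \<phi> x = x # u)"

definition morphic_fixed_point :: "'b set \<Rightarrow> ('b \<Rightarrow> 'b list) \<Rightarrow> (nat \<Rightarrow> 'b) \<Rightarrow> bool" where
  "morphic_fixed_point B \<phi> b \<longleftrightarrow>
     finite B \<and> range b \<subseteq> B \<and> morphism_on B \<phi> \<and> nonerasing_on B \<phi> \<and>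
     prolongable_on \<phi> (b 0) \<and> fixed_by \<phi> b"

(* The auxiliary alphabet B is an arbitrary finite set; its letters are named by natural numbers. *)
definition uniformly_morphic :: "nat \<Rightarrow> 'a set \<Rightarrow> (nat \<Rightarrow> 'a) \<Rightarrow> bool" where
  "uniformly_morphic k A a \<longleftrightarrow>
     (\<exists>(B :: nat set) b \<phi> \<psi>.
        morphic_fixed_point B \<phi> b \<and> uniform_on B k \<phi> \<and> \<psi> ` B \<subseteq> A \<and> (\<forall>n. a n = \<psi> (b n)))"

definition purely_morphic :: "'a set \<Rightarrow> (nat \<Rightarrow> 'a) \<Rightarrow> bool" where
  "purely_morphic A a \<longleftrightarrow> (\<exists>\<phi>. morphic_fixed_point A \<phi> a)"

end

theory Submission
  imports Defs "HOL-Library.Sublist" "HOL-Number_Theory.Cong"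
begin

text \<open>
  Appending a digit to the expansion of \<open>n\<close> completes an occurrence of \<open>w\<close> exactly when the new
  expansion ends in \<open>w\<close>. Hence the value at \<open>n\<close> together with the last digits of \<open>n\<close> is a finite
  amount of data determining the same data at \<open>p * n + d\<close> for each digit \<open>d\<close>; this defines a
  \<open>p\<close>-uniform morphism.

  For \<open>\<bar>w\<bar> > 1\<close> the sequence \<open>a\<close> satisfies \<open>a n = a (n div p)\<close> unless \<open>n\<close> lies in one fixed residue
  class modulo \<open>p\<^sup>2\<close>, and for \<open>w \<noteq> 10\<close> the first index \<open>N\<close> with \<open>a N \<noteq> 0\<close> exceeds \<open>p\<close>. If \<open>a\<close> were a
  fixed point of \<open>\<phi>\<close>, it would begin with \<open>\<phi>(0)\<^sup>N\<close>, so that its prefix of length \<open>N * l\<close> would have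
  period \<open>l = \<bar>\<phi>(0)\<bar>\<close>. Shifting by \<open>p * l\<close> takes the change of value at \<open>N\<close> to one at \<open>p * l + N\<close>,
  within a block of indices with common quotient by \<open>p\<close>. Hence \<open>p\<^sup>2\<close> divides \<open>p * l\<close>, that is, \<open>p\<close>
  divides \<open>l\<close>. But reading \<open>a\<close> along a residue class modulo \<open>p\<close> not containing \<open>N\<close> reproduces \<open>a\<close>,
  so \<open>l / p\<close> is a period of the same kind, and descent ends in a contradiction.
\<close>

section \<open>Expansions and occurrences\<close>

lemma base_expansion_less: "n < p \<Longrightarrow> base_expansion p n = [n]"
  by (simp add: base_expansion.simps)

lemma base_expansion_snoc:
  "2 \<le> p \<Longrightarrow> p \<le> n \<Longrightarrow> base_expansion p n = base_expansion p (n div p) @ [n mod p]"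
  by (subst base_expansion.simps) simp

lemma base_expansion_neq_Nil [simp]: "base_expansion p n \<noteq> []"
  by (subst base_expansion.simps) simp

lemma set_base_expansion_subset: "2 \<le> p \<Longrightarrow> set (base_expansion p n) \<subseteq> {0..<p}"
proof (induction p n rule: base_expansion.induct)
  case (1 p n)
  then show ?case
    by (cases "n < p") (auto simp: base_expansion_less base_expansion_snoc)
qed

lemma horner_sum_base_expansion: "2 \<le> p \<Longrightarrow> horner_sum id p (rev (base_expansion p n)) = n"
proof (induction p n rule: base_expansion.induct)
  case (1 p n)
  then show ?case
    by (cases "n < p") (simp_all add: base_expansion_less base_expansion_snoc)
qed

lemma base_expansion_horner_sum:
  assumes "0 < d" "set (d # w) \<subseteq> {0..<p}"
  shows "base_expansion p (horner_sum id p (rev (d # w))) = d # w"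
  using assms(2)
proof (induction w rule: rev_induct)
  case Nil
  then show ?case by (simp add: base_expansion_less)
next
  case (snoc x w)
  define n where "n = horner_sum id p (rev (d # w))"
  have expansion_n: "base_expansion p n = d # w"
    unfolding n_def using snoc.prems by (intro snoc.IH) auto
  have "n \<noteq> 0"
  proof
    assume "n = 0"
    then show False using expansion_n assms(1) snoc.prems by (auto simp: base_expansion_less)
  qed
  then have "p \<le> x + p * n" by (simp add: trans_le_add2)
  moreover have "2 \<le> p" "x < p" using assms(1) snoc.prems by auto
  ultimately have "base_expansion p (x + p * n) = base_expansion p n @ [x]"
    by (simp add: base_expansion_snoc)
  moreover have "horner_sum id p (rev (d # w @ [x])) = x + p * n" by (simp add: n_def)
  ultimately show ?case by (simp only: expansion_n append_Cons)
qed

lemma suffix_base_expansion_cong: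
  assumes "2 \<le> p" "suffix w (base_expansion p n)"
  shows "[n = horner_sum id p (rev w)] (mod p ^ length w)"
proof -
  obtain u where "base_expansion p n = u @ w" using assms(2) by (auto simp: suffix_def)
  then have "n = horner_sum id p (rev w) + p ^ length w * horner_sum id p (rev u)"
    using horner_sum_base_expansion[OF assms(1), of n] by (simp add: horner_sum_append)
  then show ?thesis by (metis cong_def mod_mult_self2)
qed

lemma occurrences_snoc:
  assumes "w \<noteq> []"
  shows "occurrences w (u @ [d]) = occurrences w u + of_bool (suffix w (u @ [d]))"
proof -
  define old where "old = {i. i + length w \<le> length u \<and> take (length w) (drop i u) = w}"
  define new where "new = {i. i + length w = Suc (length u) \<and> drop i (u @ [d]) = w}"
  have "{i. i + length w \<le> length (u @ [d]) \<and> take (length w) (drop i (u @ [d])) = w} = old \<union> new"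
    using assms by (auto simp: old_def new_def le_Suc_eq)
  moreover have "finite old"
    by (rule finite_subset[of _ "{..length u}"]) (auto simp: old_def)
  moreover have "old \<inter> new = {}" by (auto simp: old_def new_def)
  moreover have "finite new \<and> card new = of_bool (suffix w (u @ [d]))"
  proof (cases "suffix w (u @ [d])")
    case True
    then obtain v where v: "u @ [d] = v @ w" by (auto simp: suffix_def)
    then have "Suc (length u) = length v + length w"
      by (metis length_append length_append_singleton)
    with v have "new = {length v}" by (auto simp: new_def)
    with True show ?thesis by simp
  next
    case False
    then have "new = {}" unfolding new_def using suffix_drop by blast
    with False show ?thesis by simp
  qed
  ultimately show ?thesis
    by (simp add: occurrences_def card_Un_disjoint flip: old_def)
qed

lemma block_count_div:
  assumes "2 \<le> p" "w \<noteq> []" "p \<le> n"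
  shows "block_count p w n =
    block_count p w (n div p) + of_bool (suffix w (base_expansion p n))"
  using assms by (simp add: block_count_def base_expansion_snoc[of p n] occurrences_snoc)

lemma block_seq_div:
  assumes "2 \<le> p" "w \<noteq> []" "p \<le> n"
  shows "block_seq p w n =
    (block_seq p w (n div p) + of_bool (suffix w (base_expansion p n))) mod p"
  by (simp add: block_seq_def block_count_div[OF assms] mod_add_left_eq)

section \<open>Uniform morphicity\<close>

lemma seq_prefix_add: "seq_prefix b (m + n) = seq_prefix b m @ map (\<lambda>i. b (m + i)) [0..<n]"
  by (rule nth_equalityI) (auto simp: seq_prefix_def nth_append)

lemma length_seq_prefix [simp]: "length (seq_prefix b n) = n"
  by (simp add: seq_prefix_def)

lemma nth_seq_prefix [simp]: "i < n \<Longrightarrow> seq_prefix b n ! i = b i"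
  by (simp add: seq_prefix_def)

lemma ex_uniform_morphic_fixed_point:
  assumes "2 \<le> k" "finite (range b)"
    and step: "\<And>m n d. b m = b n \<Longrightarrow> d < k \<Longrightarrow> b (k * m + d) = b (k * n + d)"
  shows "\<exists>\<phi>. morphic_fixed_point (range b) \<phi> b \<and> uniform_on (range b) k \<phi>"
proof -
  define \<phi> where "\<phi> x = map (\<lambda>d. b (k * inv b x + d)) [0..<k]" for x
  have \<phi>: "\<phi> (b n) = map (\<lambda>d. b (k * n + d)) [0..<k]" for n
  proof -
    have "b (inv b (b n)) = b n" by (simp add: f_inv_into_f)
    then show ?thesis by (simp add: \<phi>_def step[of "inv b (b n)" n])
  qed
  have prefix: "morph_ext \<phi> (seq_prefix b n) = seq_prefix b (k * n)" for n
  proof (induction n)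
    case (Suc n)
    have "morph_ext \<phi> (seq_prefix b (Suc n)) = morph_ext \<phi> (seq_prefix b n) @ \<phi> (b n)"
      by (simp add: morph_ext_def seq_prefix_def)
    also have "\<dots> = seq_prefix b (k * n + k)" by (simp only: Suc \<phi> seq_prefix_add)
    finally show ?case by (simp add: add.commute)
  qed (simp add: morph_ext_def seq_prefix_def)
  have "fixed_by \<phi> b" by (simp add: fixed_by_def prefix)
  moreover have "prolongable_on \<phi> (b 0)"
    using assms(1) unfolding prolongable_on_def \<phi> by (simp add: upt_conv_Cons)
  moreover have "morphism_on (range b) \<phi>" "nonerasing_on (range b) \<phi>" "uniform_on (range b) k \<phi>"
    using assms(1) by (auto simp: morphism_on_def nonerasing_on_def uniform_on_def \<phi>)
  ultimately show ?thesis using assms(2) by (auto simp: morphic_fixed_point_def)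
qed

lemma uniformly_morphicI:
  fixes b :: "nat \<Rightarrow> 'b"
  assumes "2 \<le> k" "finite (range b)"
    and step: "\<And>m n d. b m = b n \<Longrightarrow> d < k \<Longrightarrow> b (k * m + d) = b (k * n + d)"
    and coding: "\<And>n. a n = \<psi> (b n)" and "range a \<subseteq> A"
  shows "uniformly_morphic k A a"
proof -
  obtain name :: "'b \<Rightarrow> nat" where inj: "inj_on name (range b)"
    using finite_imp_inj_to_nat_seg[OF assms(2)] by blast
  define c where "c = name \<circ> b"
  have eq_iff: "c m = c n \<longleftrightarrow> b m = b n" for m n
    using inj by (auto simp: c_def dest: inj_onD)
  have "finite (range c)" using assms(2) by (simp add: c_def comp_def finite_range_imageI)
  then obtain \<phi> where "morphic_fixed_point (range c) \<phi> c" "uniform_on (range c) k \<phi>"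
    using ex_uniform_morphic_fixed_point[of k c] assms(1) step unfolding eq_iff by blast
  moreover define \<psi>' where "\<psi>' = \<psi> \<circ> inv_into (range b) name"
  have coding': "a n = \<psi>' (c n)" for n using inj by (simp add: \<psi>'_def c_def coding)
  moreover have "\<psi>' ` range c \<subseteq> A" using assms(5) by (auto simp flip: coding')
  ultimately show ?thesis unfolding uniformly_morphic_def by blast
qed

definition trailing_digits :: "nat \<Rightarrow> nat \<Rightarrow> nat \<Rightarrow> nat list" where
  "trailing_digits p k n = take k (rev (base_expansion p n))"

lemma trailing_digits_Suc:
  assumes "2 \<le> p" "p \<le> n"
  shows "trailing_digits p (Suc k) n = n mod p # trailing_digits p k (n div p)"
  by (simp add: trailing_digits_def base_expansion_snoc[OF assms])

lemma trailing_digits_eq_mono: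
  assumes "trailing_digits p k m = trailing_digits p k n" "j \<le> k"
  shows "trailing_digits p j m = trailing_digits p j n"
  using arg_cong[OF assms(1), of "take j"] assms(2) by (simp add: trailing_digits_def min_absorb1)

lemma trailing_digits_eq_0_iff:
  assumes "2 \<le> p" "2 \<le> k"
  shows "trailing_digits p k n = [0] \<longleftrightarrow> n = 0"
proof (cases "n < p")
  case True
  then show ?thesis using assms by (simp add: trailing_digits_def base_expansion_less)
next
  case False
  moreover obtain j where "k = Suc (Suc j)" using assms(2) by (metis le_iff_add add_2_eq_Suc)
  ultimately show ?thesis
    using assms trailing_digits_Suc[of p n "Suc j"] by (simp add: trailing_digits_def)
qed

lemma suffix_base_expansion_iff_trailing_digits:
  "suffix w (base_expansion p n) \<longleftrightarrow> trailing_digits p (length w) n = rev w"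
  unfolding suffix_to_prefix trailing_digits_def
  by (metis append_eq_conv_conj length_rev prefix_def take_is_prefix)

lemma finite_range_trailing_digits:
  assumes "2 \<le> p"
  shows "finite (range (trailing_digits p k))"
proof (rule finite_subset)
  show "range (trailing_digits p k) \<subseteq> {xs. set xs \<subseteq> {0..<p} \<and> length xs \<le> k}"
    using set_base_expansion_subset[OF assms] set_take_subset
    by (fastforce simp: trailing_digits_def)
qed (simp add: finite_lists_length_le)

text \<open>
  The digit beyond the last \<open>length w\<close> ones is needed when \<open>w\<close> is a single letter: it separates \<open>0\<close>
  from the positive multiples of \<open>p\<close>.
\<close>

lemma block_seq_trailing_digits_step:
  assumes "2 \<le> p" "w \<noteq> []" "d < p"
    and seq_eq: "block_seq p w m = block_seq p w n"
    and digits_eq: "trailing_digits p (Suc (length w)) m = trailing_digits p (Suc (length w)) n"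
  shows "block_seq p w (p * m + d) = block_seq p w (p * n + d) \<and>
    trailing_digits p (Suc (length w)) (p * m + d) = trailing_digits p (Suc (length w)) (p * n + d)"
proof (cases "m = 0 \<or> n = 0")
  case True
  have "2 \<le> Suc (length w)" using assms(2) by (cases w) auto
  then have "m = n" using True digits_eq trailing_digits_eq_0_iff[OF assms(1)] by metis
  then show ?thesis by simp
next
  case False
  then have base_le: "p \<le> p * m + d" "p \<le> p * n + d" by (simp_all add: trans_le_add1)
  have "trailing_digits p (length w) m = trailing_digits p (length w) n"
    using digits_eq by (rule trailing_digits_eq_mono) simp
  then have digits_eq': "trailing_digits p (Suc (length w)) (p * m + d) =
      trailing_digits p (Suc (length w)) (p * n + d)"
    using assms(1) base_le \<open>d < p\<close> by (simp add: trailing_digits_Suc)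
  then have "suffix w (base_expansion p (p * m + d)) \<longleftrightarrow> suffix w (base_expansion p (p * n + d))"
    unfolding suffix_base_expansion_iff_trailing_digits
    using trailing_digits_eq_mono[OF digits_eq', of "length w"] by simp
  then have "block_seq p w (p * m + d) = block_seq p w (p * n + d)"
    using block_seq_div[OF assms(1,2) base_le(1)] block_seq_div[OF assms(1,2) base_le(2)]
      seq_eq \<open>d < p\<close> by simp
  with digits_eq' show ?thesis by simp
qed

lemma uniformly_morphic_block_seq:
  assumes "2 \<le> p" "w \<noteq> []"
  shows "uniformly_morphic p {0..<p} (block_seq p w)"
proof (rule uniformly_morphicI)
  let ?b = "\<lambda>n. (block_seq p w n, trailing_digits p (Suc (length w)) n)"
  show "range (block_seq p w) \<subseteq> {0..<p}"
    using assms(1) by (auto simp: block_seq_def)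
  then have "range ?b \<subseteq> {0..<p} \<times> range (trailing_digits p (Suc (length w)))" by auto
  then show "finite (range ?b)"
    by (rule finite_subset) (simp add: finite_range_trailing_digits assms(1))
  show "block_seq p w n = fst (?b n)" for n by simp
  show "?b (p * m + d) = ?b (p * n + d)" if "?b m = ?b n" "d < p" for m n d
    using block_seq_trailing_digits_step[OF assms, of d m n] that by simp
qed (rule assms(1))

section \<open>Periodic prefixes of fixed points\<close>

definition prefix_period :: "(nat \<Rightarrow> 'a) \<Rightarrow> nat \<Rightarrow> nat \<Rightarrow> bool" where
  "prefix_period a n l \<longleftrightarrow> (\<forall>m<n. a m = a (m mod l))"

lemma prefix_periodD: "prefix_period a n l \<Longrightarrow> m < n \<Longrightarrow> a m = a (m mod l)"
  by (simp add: prefix_period_def)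

lemma nth_concat_replicate:
  "m < n * length xs \<Longrightarrow> concat (replicate n xs) ! m = xs ! (m mod length xs)"
proof (induction n arbitrary: m)
  case (Suc n)
  then show ?case
    by (cases "m < length xs") (auto simp: nth_append le_mod_geq)
qed simp

lemma morphic_fixed_point_prefix_period:
  assumes "morphic_fixed_point A \<phi> a" "0 < N" and run: "\<And>n. n < N \<Longrightarrow> a n = a 0"
  shows "\<exists>l>1. prefix_period a (N * l) l"
proof -
  define l where "l = length (\<phi> (a 0))"
  have "1 < l"
    using assms(1) by (auto simp: morphic_fixed_point_def prolongable_on_def l_def)
  have power: "seq_prefix a (n * l) = concat (replicate n (\<phi> (a 0)))" if "n \<le> N" for n
  proof -
    have "seq_prefix a n = replicate n (a 0)"
      using that by (auto intro!: nth_equalityI run)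
    then have image: "morph_ext \<phi> (seq_prefix a n) = concat (replicate n (\<phi> (a 0)))"
      by (simp add: morph_ext_def)
    then have "length (morph_ext \<phi> (seq_prefix a n)) = n * l"
      by (simp add: length_concat sum_list_replicate l_def)
    moreover have "fixed_by \<phi> a" using assms(1) by (simp add: morphic_fixed_point_def)
    ultimately show ?thesis unfolding fixed_by_def using image by metis
  qed
  have root: "\<phi> (a 0) = seq_prefix a l" using power[of 1] assms(2) by simp
  have "a m = a (m mod l)" if "m < N * l" for m
  proof -
    have "a m = seq_prefix a (N * l) ! m" using that by simp
    also have "\<dots> = concat (replicate N (seq_prefix a l)) ! m"
      by (simp only: power[OF order_refl] root)
    also have "\<dots> = seq_prefix a l ! (m mod l)"
      using that by (simp add: nth_concat_replicate)
    also have "\<dots> = a (m mod l)" using \<open>1 < l\<close> by simp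
    finally show ?thesis .
  qed
  with \<open>1 < l\<close> show ?thesis by (auto simp: prefix_period_def)
qed

lemma prefix_period_greater:
  assumes "prefix_period a (N * l) l" "1 < l" and run: "\<And>n. n < N \<Longrightarrow> a n = a 0" and "a N \<noteq> a 0"
  shows "N < l"
proof (rule ccontr)
  assume "\<not> N < l"
  moreover have "N mod l < l" using assms(2) by simp
  ultimately have "N mod l < N" by linarith
  moreover have "N < N * l" using assms(2,4) by (cases "N = 0") auto
  then have "a N = a (N mod l)" using assms(1) by (rule prefix_periodD[rotated])
  ultimately show False using run[of "N mod l"] assms(4) by simp
qed

section \<open>Failure of pure morphicity\<close>

locale sparse_digit_changes =
  fixes p :: nat and a :: "nat \<Rightarrow> 'a"
  assumes base: "2 \<le> p"
    and changes_cong: "a m \<noteq> a (m div p) \<Longrightarrow> a n \<noteq> a (n div p) \<Longrightarrow> [m = n] (mod p\<^sup>2)"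
    and initial_run: "n \<le> p \<Longrightarrow> a n = a 0"
    and not_constant: "\<exists>n. a n \<noteq> a 0"
begin

definition first_change :: nat where "first_change = (LEAST n. a n \<noteq> a 0)"

lemma at_first_change: "a first_change \<noteq> a 0"
  unfolding first_change_def using not_constant by (rule LeastI_ex)

lemma below_first_change: "n < first_change \<Longrightarrow> a n = a 0"
  unfolding first_change_def using not_less_Least by blast

lemma base_less_first_change: "p < first_change"
  using at_first_change initial_run by (meson not_le)

lemma at_first_change_div: "a (first_change div p) = a 0"
  using base base_less_first_change by (intro below_first_change) simp

lemma change_cong_first_change: "a n \<noteq> a (n div p) \<Longrightarrow> [n = first_change] (mod p\<^sup>2)"
  by (rule changes_cong) (simp_all add: at_first_change at_first_change_div)

lemma no_change: "n mod p \<noteq> first_change mod p \<Longrightarrow> a n = a (n div p)"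
  using change_cong_first_change cong_dvd_modulus_nat[of n first_change "p\<^sup>2" p]
  unfolding cong_def by (metis dvd_triv_left power2_eq_square)

lemma first_change_less_prefix_period:
  "prefix_period a (first_change * l) l \<Longrightarrow> 1 < l \<Longrightarrow> first_change < l"
  by (rule prefix_period_greater) (use below_first_change at_first_change in blast)+

lemma ex_initial_value_in_shifted_block:
  assumes "1 < l" and period: "prefix_period a (first_change * l) l"
  shows "\<exists>r. r div p = first_change div p \<and> r mod p \<noteq> first_change mod p \<and> a (p * l + r) = a 0"
proof (cases "p dvd first_change")
  case True
  let ?r = "Suc first_change"
  have div: "?r div p = first_change div p" and mod: "?r mod p \<noteq> first_change mod p"
    using True base by (auto simp: div_Suc mod_Suc)
  have "a ?r = a 0" using no_change[OF mod] div at_first_change_div by simp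
  obtain q where q: "first_change = p * q" using True by blast
  then have "1 < q" using base_less_first_change by simp
  then have "p * 2 \<le> first_change" unfolding q by (intro mult_le_mono2) simp
  then have "(p + 2) * l \<le> first_change * l" using base by (intro mult_le_mono1) simp
  moreover have r_le: "?r \<le> l" using first_change_less_prefix_period[OF period assms(1)] by simp
  ultimately have "p * l + ?r < first_change * l" using assms(1) by (simp add: algebra_simps)
  then have "a (p * l + ?r) = a (?r mod l)"
    using prefix_periodD[OF period, of "p * l + ?r"] by (simp only: mod_mult_self3)
  also have "\<dots> = a 0" using r_le \<open>a ?r = a 0\<close> by (cases "?r = l") auto
  finally show ?thesis using div mod by blast
next
  case False
  obtain r where r: "first_change = Suc r" using base_less_first_change by (cases first_change) auto
  then have "r div p = first_change div p" "r mod p \<noteq> first_change mod p"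
    using False by (auto simp: div_Suc mod_Suc dvd_eq_mod_eq_0 split: if_splits)
  moreover have "a (p * l + r) = a 0"
  proof -
    have "first_change < l" using first_change_less_prefix_period[OF period assms(1)] .
    then have "p * l + r < Suc p * l" by (simp add: r)
    also have "\<dots> \<le> first_change * l" using base_less_first_change by (intro mult_le_mono1) simp
    finally have "a (p * l + r) = a r"
      using prefix_periodD[OF period, of "p * l + r"] \<open>first_change < l\<close> r by simp
    then show ?thesis using below_first_change[of r] r by simp
  qed
  ultimately show ?thesis by blast
qed

lemma base_dvd_prefix_period:
  assumes "1 < l" and period: "prefix_period a (first_change * l) l"
  shows "p dvd l"
proof -
  obtain r where r: "r div p = first_change div p" "r mod p \<noteq> first_change mod p"
    and initial: "a (p * l + r) = a 0"
    using ex_initial_value_in_shifted_block[OF assms] by blast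
  have "first_change < l" using first_change_less_prefix_period[OF period assms(1)] .
  then have "p * l + first_change < Suc p * l" by simp
  also have "\<dots> \<le> first_change * l" using base_less_first_change by (intro mult_le_mono1) simp
  finally have "a (p * l + first_change) = a first_change"
    using prefix_periodD[OF period, of "p * l + first_change"] \<open>first_change < l\<close> by simp
  moreover have "a ((p * l + first_change) div p) = a (p * l + r)"
    using no_change[of "p * l + r"] r base by simp
  ultimately have "[p * l + first_change = first_change] (mod p\<^sup>2)"
    using change_cong_first_change at_first_change initial by simp
  then have "p\<^sup>2 dvd p * l" by (simp add: cong_add_rcancel_0_nat cong_0_iff)
  then show ?thesis using base by (simp add: power2_eq_square)
qed

lemma prefix_period_div_base:
  assumes "prefix_period a (n * (p * l)) (p * l)"
  shows "prefix_period a (n * l) l"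
  unfolding prefix_period_def
proof (intro allI impI)
  fix m
  assume "m < n * l"
  define d :: nat where "d = (if first_change mod p = 0 then 1 else 0)"
  have d: "d < p" "d \<noteq> first_change mod p" using base by (auto simp: d_def)
  have subsequence: "a (p * k + d) = a k" for k
    using no_change[of "p * k + d"] d by simp
  have "p * m + d < p * Suc m" using d by simp
  also have "\<dots> \<le> p * (n * l)" using \<open>m < n * l\<close> by (intro mult_le_mono2) simp
  finally have "p * m + d < n * (p * l)" by (simp add: ac_simps)
  then have "a (p * m + d) = a ((p * m + d) mod (p * l))" by (rule prefix_periodD[OF assms])
  also have "(p * m + d) mod (p * l) = p * (m mod l) + d" using d by (simp add: mod_mult2_eq)
  finally show "a m = a (m mod l)" by (simp add: subsequence)
qed

lemma not_prefix_period:
  assumes "1 < l"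
  shows "\<not> prefix_period a (first_change * l) l"
  using assms
proof (induction l rule: less_induct)
  case (less l)
  show ?case
  proof
    assume period: "prefix_period a (first_change * l) l"
    then obtain l' where l': "l = p * l'" using base_dvd_prefix_period less.prems by blast
    have "p < l"
      using base_less_first_change first_change_less_prefix_period[OF period less.prems] by simp
    then have "1 < l'" by (simp add: l')
    moreover have "l' < l" using \<open>1 < l'\<close> base by (simp add: l')
    moreover have "prefix_period a (first_change * l') l'"
      using period prefix_period_div_base unfolding l' by blast
    ultimately show False using less.IH by blast
  qed
qed

lemma not_purely_morphic: "\<not> purely_morphic A a"
proof
  assume "purely_morphic A a"
  then obtain \<phi> where "morphic_fixed_point A \<phi> a" by (auto simp: purely_morphic_def)
  moreover have "0 < first_change" using base_less_first_change by simp
  ultimately obtain l where "1 < l" "prefix_period a (first_change * l) l"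
    using morphic_fixed_point_prefix_period[where N = first_change and a = a] below_first_change
    by blast
  then show False using not_prefix_period by blast
qed

end

lemma block_seq_eq_0_if_less_base:
  "1 < length w \<Longrightarrow> n < p \<Longrightarrow> block_seq p w n = 0"
  by (simp add: block_seq_def block_count_def occurrences_def base_expansion_less)

lemma block_seq_eq_0_if_le_base:
  assumes "2 \<le> p" "1 < length w" "w \<noteq> [1, 0]" "n \<le> p"
  shows "block_seq p w n = 0"
proof (cases "n = p")
  case True
  have "base_expansion p p = [1, 0]"
    using assms(1) by (simp add: base_expansion_snoc base_expansion_less)
  moreover have "\<not> suffix w [1, 0]" using assms(2,3) by (auto simp: suffix_Cons)
  moreover have "w \<noteq> []" using assms(2) by auto
  ultimately show ?thesis
    using True assms(1,2) block_seq_div[of p w p] by (simp add: block_seq_eq_0_if_less_base)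
next
  case False
  with assms(2,4) show ?thesis by (intro block_seq_eq_0_if_less_base) simp_all
qed

lemma suffix_if_block_seq_change:
  assumes "2 \<le> p" "1 < length w" "block_seq p w n \<noteq> block_seq p w (n div p)"
  shows "suffix w (base_expansion p n)"
proof (rule ccontr)
  assume no_suffix: "\<not> suffix w (base_expansion p n)"
  have "p \<le> n" using assms(2,3) by (cases "n < p") (simp_all add: block_seq_eq_0_if_less_base)
  moreover have "w \<noteq> []" using assms(2) by auto
  ultimately have "block_seq p w n = block_seq p w (n div p) mod p"
    using assms(1) no_suffix block_seq_div[of p w n] by simp
  then show False using assms(3) by (simp add: block_seq_def)
qed

lemma ex_block_seq_neq_0:
  assumes "2 \<le> p" "w \<noteq> []" "set w \<subseteq> {0..<p}"
  shows "\<exists>n. block_seq p w n \<noteq> 0"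
proof -
  define n where "n = horner_sum id p (rev (1 # w))"
  have expansion_n: "base_expansion p n = 1 # w"
    unfolding n_def using assms(1,3) by (intro base_expansion_horner_sum) auto
  then have "p \<le> n" using assms(2) by (metis base_expansion_less leI list.inject)
  then have "block_seq p w n = (block_seq p w (n div p) + 1) mod p"
    using block_seq_div[OF assms(1,2)] expansion_n by (simp add: suffix_Cons)
  then have "block_seq p w n \<noteq> 0 \<or> block_seq p w (n div p) \<noteq> 0"
    using assms(1) by (cases "block_seq p w (n div p) = 0") simp_all
  then show ?thesis by blast
qed

lemma sparse_digit_changes_block_seq:
  assumes "2 \<le> p" "set w \<subseteq> {0..<p}" "1 < length w" "w \<noteq> [1, 0]"
  shows "sparse_digit_changes p (block_seq p w)"
proof
  have change: "[n = horner_sum id p (rev w)] (mod p\<^sup>2)"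
    if "block_seq p w n \<noteq> block_seq p w (n div p)" for n
  proof (rule cong_dvd_modulus_nat)
    show "[n = horner_sum id p (rev w)] (mod p ^ length w)"
      using suffix_if_block_seq_change[OF assms(1,3) that] assms(1)
      by (intro suffix_base_expansion_cong)
    show "p\<^sup>2 dvd p ^ length w" using assms(3) by (intro le_imp_power_dvd) simp
  qed
  show "[m = n] (mod p\<^sup>2)"
    if "block_seq p w m \<noteq> block_seq p w (m div p)" "block_seq p w n \<noteq> block_seq p w (n div p)"
    for m n
    using change[OF that(1)] change[OF that(2)] by (metis cong_sym cong_trans)
  show "block_seq p w n = block_seq p w 0" if "n \<le> p" for n
    using block_seq_eq_0_if_le_base[OF assms(1,3,4)] that by simp
  have "block_seq p w 0 = 0" using assms by (intro block_seq_eq_0_if_le_base) simp_all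
  moreover have "w \<noteq> []" using assms(3) by auto
  ultimately show "\<exists>n. block_seq p w n \<noteq> block_seq p w 0"
    using ex_block_seq_neq_0[OF assms(1) _ assms(2)] by simp
qed (rule assms(1))

theorem theorem13:
  fixes p :: nat and w :: "nat list"
  assumes "prime p"
    and "w \<noteq> []"
    and "set w \<subseteq> {0..<p}"
  shows "uniformly_morphic p {0..<p} (block_seq p w) \<and>
    (length w > 1 \<and> w \<noteq> [1, 0] \<longrightarrow> \<not> purely_morphic {0..<p} (block_seq p w))"
proof (intro conjI impI)
  have base: "2 \<le> p" using assms(1) by (rule prime_ge_2_nat)
  show "uniformly_morphic p {0..<p} (block_seq p w)"
    using base assms(2) by (rule uniformly_morphic_block_seq)
  assume "length w > 1 \<and> w \<noteq> [1, 0]"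
  then have "sparse_digit_changes p (block_seq p w)"
    using base assms(3) by (intro sparse_digit_changes_block_seq) simp_all
  then show "\<not> purely_morphic {0..<p} (block_seq p w)"
    by (rule sparse_digit_changes.not_purely_morphic)
qed

end
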